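(* For any connected subset $A$ of a metric space $X$, $L^*(A)=L^*(\overline{A})$, where $\overline{A}$ is the closure of $A$ in $X$.
   Context: Outer linear measure on a metric space $(X,d)$ (with $\sup\emptyset=0$, $\inf\emptyset=\infty$): for $A\subseteq X$, $\operatorname{diam}(A)=\sup\{d(a_1,a_2): a_1,a_2\in A\}$. A countable family $\{U_i: i\in\mathbb{N}\}$ of subsets of $X$ is a $\delta$-cover of $A$ if $\operatorname{diam}(U_i)\le\delta$ for all $i$ and $A\subseteq\bigcup_i U_i$. For $\delta>0$, $L^*_\delta(A)=\inf\{\sum_{i\in\mathbb{N}}\operatorname{diam}(U_i): \{U_i: i\in\mathbb{N}\}\text{ is a }\delta\text{-cover of }A\}$, and $L^*(A)=\sup_{\delta>0}L^*_\delta(A)=\lim_{\delta\to0}L^*_\delta(A)\in[0,\infty]$. *)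

theory Defs
  imports "HOL-Analysis.Analysis"
begin

(* The library constant diameter is real-valued and carries no information on unbounded sets,
   so the diameter is taken in [0, infinity] here. In ennreal, Sup {} = 0 and Inf {} = top. *)
definition ediam :: "'a::metric_space set \<Rightarrow> ennreal" where
  "ediam A = (SUP (x, y) \<in> A \<times> A. ennreal (dist x y))"

definition delta_cover :: "real \<Rightarrow> 'a::metric_space set \<Rightarrow> (nat \<Rightarrow> 'a set) \<Rightarrow> bool" where
  "delta_cover \<delta> A U \<longleftrightarrow> (\<forall>i. ediam (U i) \<le> ennreal \<delta>) \<and> A \<subseteq> (\<Union>i. U i)"

definition outer_linear_delta :: "real \<Rightarrow> 'a::metric_space set \<Rightarrow> ennreal" where
  "outer_linear_delta \<delta> A = (INF U \<in> {U. delta_cover \<delta> A U}. \<Sum>i. ediam (U i))"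

definition outer_linear_measure :: "'a::metric_space set \<Rightarrow> ennreal" where
  "outer_linear_measure A = (SUP \<delta> \<in> {0<..}. outer_linear_delta \<delta> A)"

end

theory Submission
  imports Defs
begin

text \<open>
  Only the inequality from the closure to \<open>A\<close> needs an argument, and there one may assume that
  \<open>A\<close> has finite measure. Take a cover of \<open>A\<close> by open sets \<open>U\<^sub>i\<close> of diameter at most \<open>\<delta>\<close>
  whose diameters have a finite sum close to the measure (\<open>open_delta_cover\<close>). For a finite cover it would be enough to take closures, since a finite
  union of closures is closed; for an infinite cover, points of the closure of \<open>A\<close> can escape
  (as they do for a countable dense set), and connectedness must prevent this.

  Cut the cover into a finite head \<open>i < N\<close> and a tail whose diameters sum to at most \<open>\<delta>\<close>, and merge
  those tail sets that are joined by chains of overlapping tail sets into clusters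
  (\<open>cluster\<close>). Along a chain diameters add up, so a cluster is no wider than the
  total of its members (\<open>ediam_cluster_le\<close>), and in particular no wider than \<open>\<delta>\<close>. Each set belongs to one cluster, so the
  clusters still cost no more than the original cover (\<open>suminf_ediam_cluster_le\<close>).
  A cluster is disjoint from all tail sets outside it, so if it also missed
  the head it would separate \<open>A\<close>; hence every cluster that meets \<open>A\<close> touches the head
  (\<open>cluster_meets_head\<close>). Now let \<open>x\<close> be a limit of \<open>A\<close> outside the closed set formed by
  the closures of the head. Clusters that come near \<open>x\<close> stretch from near \<open>x\<close> to the
  head, so their diameters are bounded below, so there are finitely many of them, and \<open>x\<close> lies in
  the closure of one. Therefore the closures of the clusters form a
  \<open>\<delta>\<close>-cover of the closure of \<open>A\<close> that costs no more than the \<open>U\<^sub>i\<close>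
  (\<open>delta_cover_closure\<close>).
\<close>

section \<open>Diameters with values in the extended nonnegative reals\<close>

lemma ediam_le_iff: "ediam S \<le> c \<longleftrightarrow> (\<forall>x\<in>S. \<forall>y\<in>S. ennreal (dist x y) \<le> c)"
  by (auto simp: ediam_def SUP_le_iff)

lemma ediamI: "(\<And>x y. x \<in> S \<Longrightarrow> y \<in> S \<Longrightarrow> ennreal (dist x y) \<le> c) \<Longrightarrow> ediam S \<le> c"
  by (simp add: ediam_le_iff)

lemma dist_le_ediam: "x \<in> S \<Longrightarrow> y \<in> S \<Longrightarrow> ennreal (dist x y) \<le> ediam S"
  using ediam_le_iff[of S "ediam S"] by auto

lemma ennreal_dist_triangle: "ennreal (dist x z) \<le> ennreal (dist x y) + ennreal (dist y z)"
  by (metis dist_triangle ennreal_leI ennreal_plus zero_le_dist)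

lemma ediam_neighbourhood_le:
  assumes "r \<ge> 0"
  shows "ediam (\<Union>s\<in>S. ball s r) \<le> ediam S + ennreal (2 * r)"
proof (rule ediamI)
  fix x y assume "x \<in> (\<Union>s\<in>S. ball s r)" "y \<in> (\<Union>s\<in>S. ball s r)"
  then obtain s t where st: "s \<in> S" "t \<in> S" "dist s x < r" "dist t y < r" by auto
  have "dist x y \<le> dist s t + 2 * r"
    using dist_triangle[of x y s] dist_triangle[of s y t] st by (simp add: dist_commute)
  then have "ennreal (dist x y) \<le> ennreal (dist s t) + ennreal (2 * r)"
    using assms by (metis ennreal_leI ennreal_plus mult_nonneg_nonneg zero_le_dist zero_le_numeral)
  also have "\<dots> \<le> ediam S + ennreal (2 * r)"
    using dist_le_ediam[OF st(1,2)] by (rule add_right_mono)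
  finally show "ennreal (dist x y) \<le> ediam S + ennreal (2 * r)" .
qed

lemma ediam_mono: "S \<subseteq> T \<Longrightarrow> ediam S \<le> ediam T"
  by (meson dist_le_ediam ediamI subsetD)

lemma ediam_closure_le: "ediam (closure S) \<le> ediam S"
proof (rule ennreal_le_epsilon)
  fix e :: real assume e: "0 < e"
  have "closure S \<subseteq> (\<Union>s\<in>S. ball s (e/2))"
    using closure_approachableD[of _ S "e/2"] e by (fastforce simp: dist_commute)
  then have "ediam (closure S) \<le> ediam (\<Union>s\<in>S. ball s (e/2))"
    by (rule ediam_mono)
  also have "\<dots> \<le> ediam S + ennreal (2 * (e/2))"
    using e by (intro ediam_neighbourhood_le) auto
  finally show "ediam (closure S) \<le> ediam S + ennreal e" by simp
qed

section \<open>Series of extended nonnegative reals\<close>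

lemma suminf_ennreal_swap:
  fixes f :: "nat \<Rightarrow> nat \<Rightarrow> ennreal"
  shows "(\<Sum>i. \<Sum>j. f i j) = (\<Sum>j. \<Sum>i. f i j)"
proof -
  have "(\<Sum>j. \<Sum>i. f i j) = (\<integral>\<^sup>+ j. (\<Sum>i. f i j) \<partial>count_space UNIV)"
    by (rule nn_integral_count_space_nat[symmetric])
  also have "\<dots> = (\<Sum>i. \<integral>\<^sup>+ j. f i j \<partial>count_space UNIV)"
    by (rule nn_integral_suminf) simp
  finally show ?thesis by (simp add: nn_integral_count_space_nat)
qed

lemma suminf_fibres:
  fixes d :: "nat \<Rightarrow> ennreal" and p :: "nat \<Rightarrow> nat"
  shows "(\<Sum>i. \<Sum>j. if p j = i then d j else 0) = (\<Sum>j. d j)"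
proof -
  have "(\<Sum>i. if p j = i then d j else 0) = d j" for j
    using sums_single[of "p j" "\<lambda>_. d j"] by (simp add: sums_iff eq_commute)
  then show ?thesis by (subst suminf_ennreal_swap) simp
qed

lemma suminf_le_tail:
  fixes d :: "nat \<Rightarrow> ennreal"
  assumes "\<And>j. j < n \<Longrightarrow> \<not> P j"
  shows "(\<Sum>j. if P j then d j else 0) \<le> (\<Sum>j. d (j + n))"
proof -
  have "(\<Sum>j. if P j then d j else 0) = (\<Sum>j. if P (j + n) then d (j + n) else 0)
      + (\<Sum>j<n. if P j then d j else 0)"
    by (rule suminf_offset) (rule summableI)
  also have "(\<Sum>j<n. if P j then d j else 0) = 0"
    using assms by (intro sum.neutral) auto
  also have "(\<Sum>j. if P (j + n) then d (j + n) else 0) + 0 \<le> (\<Sum>j. d (j + n))"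
    unfolding add_0_right by (intro suminf_le summableI) simp
  finally show ?thesis .
qed

lemma ennreal_tails_small:
  fixes d :: "nat \<Rightarrow> ennreal"
  assumes "(\<Sum>i. d i) < top" and "0 < e"
  shows "\<exists>N. \<forall>n\<ge>N. (\<Sum>i. d (i + n)) < ennreal e"
proof -
  have "d i < top" for i using assms(1) by (rule ennreal_suminf_lessD)
  define r where "r = (\<lambda>i. enn2real (d i))"
  have d: "d = (\<lambda>i. ennreal (r i))" and r: "\<And>i. r i \<ge> 0"
    using \<open>\<And>i. d i < top\<close> by (auto simp: r_def)
  have s: "summable r"
    using assms(1) r by (intro summable_suminf_not_top) (auto simp: d)
  obtain N where N: "\<And>n. n \<ge> N \<Longrightarrow> norm (\<Sum>i. r (i + n)) < e"
    using suminf_exist_split[OF assms(2) s] by auto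
  have "(\<Sum>i. d (i + n)) < ennreal e" if "n \<ge> N" for n
  proof -
    have "summable (\<lambda>i. r (i + n))" using s by (simp add: summable_iff_shift)
    then have "(\<Sum>i. d (i + n)) = ennreal (\<Sum>i. r (i + n))"
      unfolding d using r by (intro suminf_ennreal2) auto
    then show ?thesis using N[OF that] assms(2) by (simp add: ennreal_lessI)
  qed
  then show ?thesis by blast
qed

section \<open>Covers by open sets\<close>

lemma outer_linear_measure_mono:
  assumes "A \<subseteq> B"
  shows "outer_linear_measure A \<le> outer_linear_measure B"
  unfolding outer_linear_measure_def outer_linear_delta_def
  proof (intro SUP_mono' INF_superset_mono order_refl Collect_mono impI)
  show "delta_cover \<delta> A U" if "delta_cover \<delta> B U" for \<delta> U
    using that assms unfolding delta_cover_def by (meson subset_trans)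
qed

text \<open>
  Starting from a \<open>\<delta>/2\<close>-cover that is optimal up to \<open>e\<close> leaves room to replace the \<open>i\<close>-th set by
  its neighbourhood of radius \<open>\<eta> / 2^(i+2)\<close> with \<open>\<eta> = min e (\<delta>/2)\<close>. This adds at most
  \<open>\<eta> / 2^(i+1)\<close> to its diameter, hence at most \<open>e\<close> to the sum.
\<close>

lemma open_delta_cover:
  assumes "outer_linear_measure A < top" and "0 < \<delta>" and "0 < e"
  shows "\<exists>U. delta_cover \<delta> A U \<and> (\<forall>i. open (U i))
    \<and> (\<Sum>i. ediam (U i)) < outer_linear_measure A + ennreal (2 * e)"
proof -
  define \<eta> where "\<eta> = min e (\<delta>/2)"
  have \<eta>: "0 < \<eta>" "\<eta> \<le> e" "\<eta> \<le> \<delta>/2" using assms by (auto simp: \<eta>_def)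
  have "outer_linear_delta (\<delta>/2) A \<le> outer_linear_measure A"
    unfolding outer_linear_measure_def using assms by (intro SUP_upper) auto
  also have "\<dots> < outer_linear_measure A + ennreal e"
    using assms(1,3) by (cases "outer_linear_measure A")
      (auto simp: ennreal_lessI simp flip: ennreal_plus)
  finally obtain V where V: "delta_cover (\<delta>/2) A V"
    and sumV: "(\<Sum>i. ediam (V i)) < outer_linear_measure A + ennreal e"
    unfolding outer_linear_delta_def by (auto simp: INF_less_iff)
  define \<rho> where "\<rho> i = \<eta> * (1/2) ^ Suc i" for i
  have \<rho>: "0 < \<rho> i" "\<rho> i \<le> \<eta>" for i
    using \<eta> mult_left_mono[of "(1/2) ^ Suc i" 1 \<eta>] power_le_one[of "1/2::real" "Suc i"]
    by (auto simp: \<rho>_def simp del: power_Suc)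
  define U where "U i = (\<Union>s\<in>V i. ball s (\<rho> i / 2))" for i
  have dU: "ediam (U i) \<le> ediam (V i) + ennreal (\<rho> i)" for i
    using ediam_neighbourhood_le[of "\<rho> i / 2" "V i"] \<rho>(1)[of i] by (simp add: U_def)
  have "\<rho> sums \<eta>"
    unfolding \<rho>_def using sums_mult[OF power_half_series, of \<eta>] by simp
  then have sum\<rho>: "(\<Sum>i. ennreal (\<rho> i)) = ennreal \<eta>"
    using \<rho>(1) by (intro suminf_ennreal_eq) (auto intro: less_imp_le)
  have "ediam (U i) \<le> ennreal \<delta>" for i
  proof -
    have "ediam (U i) \<le> ennreal (\<delta>/2) + ennreal (\<rho> i)"
      using dU[of i] V by (meson add_right_mono delta_cover_def order_trans)
    also have "\<dots> = ennreal (\<delta>/2 + \<rho> i)" using assms \<rho>(1)[of i] by simp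
    also have "\<dots> \<le> ennreal \<delta>" using \<rho>(2)[of i] \<eta> by (intro ennreal_leI) linarith
    finally show ?thesis .
  qed
  moreover have "A \<subseteq> (\<Union>i. U i)"
  proof
    fix a assume "a \<in> A"
    then obtain i where "a \<in> V i" using V by (auto simp: delta_cover_def)
    then have "a \<in> U i" using \<rho>(1)[of i] by (auto simp: U_def intro!: bexI[of _ a])
    then show "a \<in> (\<Union>i. U i)" by blast
  qed
  moreover have "open (U i)" for i unfolding U_def by blast
  moreover have "(\<Sum>i. ediam (U i)) < outer_linear_measure A + ennreal (2 * e)"
  proof -
    have "(\<Sum>i. ediam (U i)) \<le> (\<Sum>i. ediam (V i) + ennreal (\<rho> i))"
      using dU by (intro suminf_le) auto
    also have "\<dots> = (\<Sum>i. ediam (V i)) + ennreal \<eta>"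
      by (subst suminf_add[symmetric]) (auto simp: sum\<rho>)
    also have "\<dots> \<le> (\<Sum>i. ediam (V i)) + ennreal e"
      using \<eta> by (intro add_left_mono ennreal_leI) auto
    also have "\<dots> < (outer_linear_measure A + ennreal e) + ennreal e"
      using sumV by (simp add: ennreal_add_left_cancel_less add.commute)
    also have "\<dots> = outer_linear_measure A + ennreal (2 * e)"
      using assms by (simp add: add.assoc flip: ennreal_plus)
    finally show ?thesis .
  qed
  ultimately show ?thesis by (auto simp: delta_cover_def)
qed

section \<open>Clusters of overlapping sets\<close>

text \<open>
  Two indices are linked when they are equal or joined by a chain of overlapping sets that all
  belong to the tail \<open>i \<ge> N\<close>. In particular a head index is linked to itself only.
\<close>

definition linked :: "(nat \<Rightarrow> 'a set) \<Rightarrow> nat \<Rightarrow> (nat \<times> nat) set" where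
  "linked U N = {(i, j). N \<le> i \<and> N \<le> j \<and> U i \<inter> U j \<noteq> {}}\<^sup>*"

definition rep :: "(nat \<Rightarrow> 'a set) \<Rightarrow> nat \<Rightarrow> nat \<Rightarrow> nat" where
  "rep U N j = (LEAST i. (i, j) \<in> linked U N)"

text \<open>
  A cluster is stored at the least index of its members and every other index carries the empty
  set. The clusters thus form a sequence again, and the cluster at index \<open>i \<ge> n\<close> has all its members
  in the tail \<open>j \<ge> n\<close>.
\<close>

definition cluster :: "(nat \<Rightarrow> 'a set) \<Rightarrow> nat \<Rightarrow> nat \<Rightarrow> 'a set" where
  "cluster U N i = (\<Union>j\<in>{j. rep U N j = i}. U j)"

lemma linked_refl: "(i, i) \<in> linked U N"
  by (simp add: linked_def)

lemma linked_trans: "(i, j) \<in> linked U N \<Longrightarrow> (j, k) \<in> linked U N \<Longrightarrow> (i, k) \<in> linked U N"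
  unfolding linked_def by (rule rtrancl_trans)

lemma linked_sym: "(i, j) \<in> linked U N \<Longrightarrow> (j, i) \<in> linked U N"
proof -
  have "sym (linked U N)"
    unfolding linked_def by (intro sym_rtrancl) (auto simp: sym_def)
  then show "(i, j) \<in> linked U N \<Longrightarrow> (j, i) \<in> linked U N" by (rule symD)
qed

lemma linked_overlap: "N \<le> i \<Longrightarrow> N \<le> j \<Longrightarrow> U i \<inter> U j \<noteq> {} \<Longrightarrow> (i, j) \<in> linked U N"
  unfolding linked_def by (intro r_into_rtrancl) simp

lemma linked_head: "(i, j) \<in> linked U N \<Longrightarrow> i < N \<or> j < N \<Longrightarrow> i = j"
  unfolding linked_def by (drule rtranclD) (use tranclD tranclD2 in fastforce)

lemma rep_linked: "(rep U N j, j) \<in> linked U N"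
  unfolding rep_def by (rule LeastI[of _ j]) (rule linked_refl)

lemma rep_le: "rep U N j \<le> j"
  unfolding rep_def by (rule Least_le) (rule linked_refl)

lemma rep_eq_iff: "rep U N i = rep U N j \<longleftrightarrow> (i, j) \<in> linked U N"
proof
  assume "rep U N i = rep U N j"
  then show "(i, j) \<in> linked U N"
    using rep_linked[of U N i] rep_linked[of U N j] by (metis linked_sym linked_trans)
next
  assume "(i, j) \<in> linked U N"
  then have "(k, i) \<in> linked U N \<longleftrightarrow> (k, j) \<in> linked U N" for k
    using linked_sym linked_trans by metis
  then show "rep U N i = rep U N j" by (simp add: rep_def)
qed

lemma cluster_head: "i < N \<Longrightarrow> cluster U N i = U i"
proof -
  assume i: "i < N"
  have "rep U N j = i \<longleftrightarrow> j = i" for j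
    using linked_head[OF rep_linked[of U N j]] i rep_le[of U N j] by auto
  then show ?thesis by (simp add: cluster_def)
qed

lemma open_cluster: "(\<And>i. open (U i)) \<Longrightarrow> open (cluster U N i)"
  by (auto simp: cluster_def)

text \<open>
  The finite set \<open>F\<close> collects the indices along a chain from \<open>i\<close> to \<open>j\<close>. The bound is demanded for
  the points of all the sets met so far, not just of the last one: when the chain revisits
  an index, whose diameter may not be counted twice, that index already obeys the bound.
\<close>

lemma chain_diameter:
  assumes "(i, j) \<in> linked U N"
  shows "\<exists>F. finite F \<and> j \<in> F \<and> (\<forall>k\<in>F. (i, k) \<in> linked U N) \<and>
    (\<forall>x\<in>U i. \<forall>k\<in>F. \<forall>y\<in>U k. ennreal (dist x y) \<le> (\<Sum>l\<in>F. ediam (U l)))"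
  using assms[unfolded linked_def]
proof (induction rule: rtrancl_induct)
  case base
  show ?case by (intro exI[of _ "{i}"]) (auto simp: linked_refl dist_le_ediam)
next
  case (step j m)
  then obtain F where F: "finite F" "j \<in> F" "\<forall>k\<in>F. (i, k) \<in> linked U N"
    and bound: "\<forall>x\<in>U i. \<forall>k\<in>F. \<forall>y\<in>U k. ennreal (dist x y) \<le> (\<Sum>l\<in>F. ediam (U l))"
    by (elim exE conjE)
  from step(2) have jm: "N \<le> j" "N \<le> m" "U j \<inter> U m \<noteq> {}" by auto
  show ?case
  proof (cases "m \<in> F")
    case True
    with F bound show ?thesis by (intro exI[of _ F] conjI)
  next
    case False
    have im: "(i, m) \<in> linked U N"
      using bspec[OF F(3,2)] linked_overlap[OF jm] by (rule linked_trans)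
    have "ennreal (dist x y) \<le> (\<Sum>l\<in>insert m F. ediam (U l))"
      if x: "x \<in> U i" and k: "k \<in> insert m F" and y: "y \<in> U k" for x k y
    proof (cases "k = m")
      case True
      obtain z where z: "z \<in> U j" "z \<in> U m" using jm by blast
      have "ennreal (dist x y) \<le> ennreal (dist x z) + ennreal (dist z y)"
        by (rule ennreal_dist_triangle)
      also have "\<dots> \<le> (\<Sum>l\<in>F. ediam (U l)) + ediam (U m)"
        using bound x F(2) z(1) dist_le_ediam[OF z(2)] y True by (intro add_mono) blast+
      finally show ?thesis using False F(1) by (simp add: add.commute)
    next
      case False
      then have "ennreal (dist x y) \<le> (\<Sum>l\<in>F. ediam (U l))" using bound x k y by blast
      also have "\<dots> \<le> (\<Sum>l\<in>insert m F. ediam (U l))" using F(1) by (intro sum_mono2) auto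
      finally show ?thesis .
    qed
    then show ?thesis using F im by (intro exI[of _ "insert m F"]) auto
  qed
qed

lemma ediam_cluster_le:
  "ediam (cluster U N i) \<le> (\<Sum>j. if rep U N j = i then ediam (U j) else 0)"
proof (rule ediamI)
  fix x y assume "x \<in> cluster U N i" "y \<in> cluster U N i"
  then obtain j k where jk: "rep U N j = i" "x \<in> U j" "rep U N k = i" "y \<in> U k"
    by (auto simp: cluster_def)
  then have "(j, k) \<in> linked U N" by (simp flip: rep_eq_iff)
  from chain_diameter[OF this] obtain F where F: "finite F" "\<And>l. l \<in> F \<Longrightarrow> (j, l) \<in> linked U N"
    and le: "ennreal (dist x y) \<le> (\<Sum>l\<in>F. ediam (U l))"
    using jk by blast
  have "rep U N l = i" if "l \<in> F" for l
    using F(2)[OF that] jk(1) by (simp flip: rep_eq_iff)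
  then have "(\<Sum>l\<in>F. ediam (U l)) = (\<Sum>l\<in>F. if rep U N l = i then ediam (U l) else 0)"
    by (intro sum.cong) auto
  also have "\<dots> \<le> (\<Sum>l. if rep U N l = i then ediam (U l) else 0)"
    using F(1) by (intro sum_le_suminf summableI) auto
  finally show "ennreal (dist x y) \<le> (\<Sum>l. if rep U N l = i then ediam (U l) else 0)"
    using le by (rule order_trans[rotated])
qed

lemma suminf_ediam_cluster_le: "(\<Sum>i. ediam (cluster U N i)) \<le> (\<Sum>i. ediam (U i))"
proof -
  have "(\<Sum>i. ediam (cluster U N i)) \<le> (\<Sum>i. \<Sum>j. if rep U N j = i then ediam (U j) else 0)"
    using ediam_cluster_le by (intro suminf_le) auto
  then show ?thesis by (simp only: suminf_fibres)
qed

lemma ediam_cluster_le_tail: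
  assumes "n \<le> i"
  shows "ediam (cluster U N i) \<le> (\<Sum>j. ediam (U (j + n)))"
proof -
  have "rep U N j \<noteq> i" if "j < n" for j
    using rep_le[of U N j] that assms by linarith
  then have "(\<Sum>j. if rep U N j = i then ediam (U j) else 0) \<le> (\<Sum>j. ediam (U (j + n)))"
    by (rule suminf_le_tail)
  with ediam_cluster_le show ?thesis by (rule order_trans)
qed

section \<open>Closures of clusters cover the closure of a connected set\<close>

text \<open>
  A set of the cover outside the cluster can overlap the cluster only if it belongs to the head.
  If none does, the cluster and the union of the remaining sets are disjoint open sets that
  cover \<open>A\<close>, so that \<open>A\<close> lies inside the cluster. Then the head set that meets \<open>A\<close>
  meets the cluster after all.
\<close>

lemma cluster_meets_head:
  assumes A: "connected A" "A \<subseteq> (\<Union>i. U i)" and U: "\<And>i. open (U i)"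
    and head: "h < N" "A \<inter> U h \<noteq> {}"
    and i: "A \<inter> cluster U N i \<noteq> {}"
  shows "\<exists>k<N. U k \<inter> cluster U N i \<noteq> {}"
proof (rule ccontr)
  assume no: "\<not> ?thesis"
  define R where "R = (\<Union>j\<in>{j. rep U N j \<noteq> i}. U j)"
  have disj: "cluster U N i \<inter> R = {}"
  proof (rule ccontr)
    assume "cluster U N i \<inter> R \<noteq> {}"
    then obtain j l where jl: "rep U N j = i" "rep U N l \<noteq> i" "U j \<inter> U l \<noteq> {}"
      by (auto simp: cluster_def R_def)
    moreover have "N \<le> l"
      using no jl by (force simp: cluster_def not_less[symmetric])
    moreover have "N \<le> j"
      using no jl by (force simp: cluster_def not_less[symmetric])
    ultimately show False
      using linked_overlap[of N j l U] by (simp flip: rep_eq_iff)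
  qed
  have cov: "A \<subseteq> cluster U N i \<union> R" using A(2) by (auto simp: cluster_def R_def)
  have "open R" using U by (auto simp: R_def)
  then have "cluster U N i \<inter> A = {} \<or> R \<inter> A = {}"
    using disj cov by (intro connectedD[OF A(1) open_cluster[OF U]]) auto
  with i cov have "A \<subseteq> cluster U N i" by blast
  then show False using no head by blast
qed

lemma closure_subset_closure_clusters:
  fixes A :: "'a::metric_space set"
  assumes A: "connected A" "A \<subseteq> (\<Union>i. U i)" and U: "\<And>i. open (U i)"
    and sum: "(\<Sum>i. ediam (U i)) < top"
    and head: "h < N" "A \<inter> U h \<noteq> {}"
  shows "closure A \<subseteq> (\<Union>i. closure (cluster U N i))"
proof
  fix x assume x: "x \<in> closure A"
  show "x \<in> (\<Union>i. closure (cluster U N i))"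
  proof (rule ccontr)
    assume "x \<notin> (\<Union>i. closure (cluster U N i))"
    then have far: "x \<notin> closure (cluster U N i)" for i by blast
    have away: "\<exists>e>0. \<forall>i<m. ball x e \<inter> cluster U N i = {}" for m
    proof -
      have "open (- (\<Union>i<m. closure (cluster U N i)))"
        by (intro open_Compl closed_UN) auto
      moreover have "x \<in> - (\<Union>i<m. closure (cluster U N i))" using far by auto
      ultimately obtain e where "e > 0" "ball x e \<subseteq> - (\<Union>i<m. closure (cluster U N i))"
        by (meson openE)
      then show ?thesis using closure_subset by (intro exI[of _ e]) blast
    qed
    obtain e where e: "e > 0" "\<And>k. k < N \<Longrightarrow> ball x e \<inter> U k = {}"
      using away[of N] by (auto simp: cluster_head)
    \<comment> \<open>From index \<open>m\<close> on, clusters are too small to reach from within \<open>e/2\<close> of \<open>x\<close> to the head;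
        a point of \<open>A\<close> that avoids the first \<open>m\<close> clusters lies in one that must do so.\<close>
    obtain m where m: "(\<Sum>j. ediam (U (j + m))) < ennreal (e/2)"
      using ennreal_tails_small[OF sum, of "e/2"] e by auto
    obtain e' where e': "e' > 0" "\<And>i. i < m \<Longrightarrow> ball x e' \<inter> cluster U N i = {}"
      using away[of m] by auto
    obtain a where a: "a \<in> A" "dist a x < min e' (e/2)"
      using x e(1) e'(1) unfolding closure_approachable
      by (metis half_gt_zero min_less_iff_conj)
    obtain i where i: "a \<in> cluster U N i"
      using a(1) A(2) unfolding cluster_def by blast
    have "m \<le> i"
      using e'(2)[of i] i a(2) by (force simp: dist_commute not_less[symmetric])
    obtain k v where kv: "k < N" "v \<in> U k" "v \<in> cluster U N i"
      using cluster_meets_head[OF A U head, of i] a(1) i by blast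
    have "ennreal (dist a v) \<le> ediam (cluster U N i)"
      using i kv(3) by (rule dist_le_ediam)
    also have "\<dots> \<le> (\<Sum>j. ediam (U (j + m)))"
      using \<open>m \<le> i\<close> by (rule ediam_cluster_le_tail)
    also note m
    finally have "dist a v < e/2" using e(1) by (simp add: ennreal_less_iff)
    then have "dist x v < e"
      using dist_triangle[of x v a] a(2) by (simp add: dist_commute)
    then show False using e(2)[OF kv(1)] kv(2) by auto
  qed
qed

lemma delta_cover_closure:
  fixes A :: "'a::metric_space set"
  assumes A: "connected A" and cover: "delta_cover \<delta> A U" and U: "\<And>i. open (U i)"
    and sum: "(\<Sum>i. ediam (U i)) < top" and "0 < \<delta>"
  shows "\<exists>W. delta_cover \<delta> (closure A) W \<and> (\<Sum>i. ediam (W i)) \<le> (\<Sum>i. ediam (U i))"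
proof (cases "A = {}")
  case True
  then show ?thesis using cover by (intro exI[of _ U]) (auto simp: delta_cover_def)
next
  case False
  have AU: "A \<subseteq> (\<Union>i. U i)" and dU: "\<And>i. ediam (U i) \<le> ennreal \<delta>"
    using cover by (auto simp: delta_cover_def)
  obtain h where h: "A \<inter> U h \<noteq> {}" using False AU by blast
  obtain N0 where N0: "\<And>n. n \<ge> N0 \<Longrightarrow> (\<Sum>j. ediam (U (j + n))) < ennreal \<delta>"
    using ennreal_tails_small[OF sum \<open>0 < \<delta>\<close>] by blast
  define N where "N = max N0 (Suc h)"
  define W where "W i = closure (cluster U N i)" for i
  have W: "ediam (W i) \<le> ediam (cluster U N i)" for i
    unfolding W_def by (rule ediam_closure_le)
  have "ediam (cluster U N i) \<le> ennreal \<delta>" for i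
  proof (cases "i < N")
    case True
    then show ?thesis using dU by (simp add: cluster_head)
  next
    case False
    then have "ediam (cluster U N i) \<le> (\<Sum>j. ediam (U (j + N)))"
      by (intro ediam_cluster_le_tail) simp
    also have "\<dots> < ennreal \<delta>" by (rule N0) (simp add: N_def)
    finally show ?thesis by simp
  qed
  moreover have "closure A \<subseteq> (\<Union>i. W i)"
    unfolding W_def using closure_subset_closure_clusters[OF A AU U sum _ h, of N]
    by (simp add: N_def)
  ultimately have "delta_cover \<delta> (closure A) W"
    using W by (auto simp: delta_cover_def intro: order_trans)
  moreover have "(\<Sum>i. ediam (W i)) \<le> (\<Sum>i. ediam (cluster U N i))"
    using W by (intro suminf_le) auto
  ultimately show ?thesis using suminf_ediam_cluster_le order_trans by blast
qed

theorem corollary4: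
  fixes A :: "'a::metric_space set"
  assumes "connected A"
  shows "outer_linear_measure A = outer_linear_measure (closure A)"
proof (rule antisym)
  show "outer_linear_measure A \<le> outer_linear_measure (closure A)"
    by (intro outer_linear_measure_mono closure_subset)
  show "outer_linear_measure (closure A) \<le> outer_linear_measure A"
  proof (cases "outer_linear_measure A < top")
    case False
    then show ?thesis by (simp add: not_less top_unique)
  next
    case True
    have "outer_linear_delta \<delta> (closure A) \<le> outer_linear_measure A" if "\<delta> > 0" for \<delta>
    proof (rule ennreal_le_epsilon)
      fix e :: real assume "0 < e"
      then obtain U where U: "delta_cover \<delta> A U" "\<And>i. open (U i)"
        and sum: "(\<Sum>i. ediam (U i)) < outer_linear_measure A + ennreal (2 * (e/2))"
        using open_delta_cover[OF True \<open>\<delta> > 0\<close>, of "e/2"] by auto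
      have "(\<Sum>i. ediam (U i)) < top"
        using sum by (rule less_le_trans) simp
      then obtain W where W: "delta_cover \<delta> (closure A) W"
        "(\<Sum>i. ediam (W i)) \<le> (\<Sum>i. ediam (U i))"
        using delta_cover_closure[OF assms U] \<open>\<delta> > 0\<close> by blast
      have "outer_linear_delta \<delta> (closure A) \<le> (\<Sum>i. ediam (W i))"
        unfolding outer_linear_delta_def using W(1) by (intro INF_lower) simp
      also note W(2)
      also note sum
      finally show "outer_linear_delta \<delta> (closure A) \<le> outer_linear_measure A + ennreal e"
        by simp
    qed
    then show ?thesis
      unfolding outer_linear_measure_def[of "closure A"] by (intro SUP_least) simp
  qed
qed

end
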